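(* Let $X$ be a real Banach space and let $I=\Psi+\Phi:X\to(-\infty,+\infty]$, where $\Psi:X\to(-\infty,+\infty]$ is proper, convex and lower semicontinuous and $\Phi\in C^1(X,\mathbb R)$. Assume that $I$ satisfies the Palais–Smale condition, that $I(0)=0$, that there exist $\rho,\alpha>0$ such that $I(u)\ge\alpha$ for every $u\in X$ with $\|u\|=\rho$, and that there exists $e\in X\setminus B_\rho(0)$ with $I(e)\le0$. Let $p:X\to X$ be a continuous map satisfying $$p(0)=0,\qquad p(e)=e,\qquad p\circ p=p,$$ $$\|p(u)-p(v)\|\le\|u-v\|\quad\text{for every }u,v\in X,$$ and $$I(p(u))\le I(u)\quad\text{for every }u\in X.$$ Then the mountain pass level $$c=\inf_{\gamma\in\Gamma}\sup_{t\in[0,1]}I(\gamma(t)),\qquad \Gamma=\{\gamma\in C([0,1],X):\gamma(0)=0,\ \gamma(1)=e\},$$ is attained by a critical point $u\in p(X)$; that is, there is a critical point $u$ of $I$ with $u\in p(X)$ and $I(u)=c$.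
   Context: $D(\Psi):=\{u\in X:\Psi(u)<+\infty\}$; $B_\rho(0)$ is the ball of radius $\rho$ centered at $0$. A point $u\in X$ is a critical point of $I$ if $u\in D(\Psi)$ and $\Phi'(u)(v-u)+\Psi(v)-\Psi(u)\ge0$ for every $v\in X$. $I$ satisfies the Palais–Smale condition if every sequence $\{u_n\}\subset D(\Psi)$ with $I(u_n)\to c'\in\mathbb R$ and $$\Psi(v)-\Psi(u_n)+\Phi'(u_n)(v-u_n)\ge-\varepsilon_n\|v-u_n\|\quad\text{for all }v\in X,$$ for some $\varepsilon_n\to0^+$, has a convergent subsequence. *)

theory Defs
  imports "HOL-Analysis.Analysis"
begin

text \<open>
  Functions into \<open>(-\<infinity>, +\<infinity>]\<close> are represented as \<^typ>\<open>ereal\<close>-valued functions; \<open>proper_fun\<close>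
  excludes the value \<open>-\<infinity>\<close> as well as the constant \<open>+\<infinity>\<close>.
\<close>

definition eff_domain :: "('a \<Rightarrow> ereal) \<Rightarrow> 'a set" where
  "eff_domain \<Psi> = {u. \<Psi> u < \<infinity>}"

definition proper_fun :: "('a \<Rightarrow> ereal) \<Rightarrow> bool" where
  "proper_fun \<Psi> \<longleftrightarrow> (\<forall>u. \<Psi> u \<noteq> -\<infinity>) \<and> eff_domain \<Psi> \<noteq> {}"

text \<open>
  The library's \<^const>\<open>convex_on\<close> is restricted to real-valued functions. The parameter ranges over
  the open interval, so the convention \<open>0 * \<infinity> = 0\<close> of \<^typ>\<open>ereal\<close> plays no role.
\<close>

definition convex_fun :: "('a::real_vector \<Rightarrow> ereal) \<Rightarrow> bool" where
  "convex_fun \<Psi> \<longleftrightarrow>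
     (\<forall>x y. \<forall>t\<in>{0<..<1::real}.
        \<Psi> ((1 - t) *\<^sub>R x + t *\<^sub>R y) \<le> ereal (1 - t) * \<Psi> x + ereal t * \<Psi> y)"

definition lower_semicont :: "('a::topological_space \<Rightarrow> ereal) \<Rightarrow> bool" where
  "lower_semicont \<Psi> \<longleftrightarrow> (\<forall>x. \<forall>a < \<Psi> x. \<forall>\<^sub>F y in nhds x. a < \<Psi> y)"

text \<open>
  Continuous Frechet differentiability; continuity of the derivative is with respect to the
  operator norm on the dual space.
\<close>

definition C1_fun :: "('a::real_normed_vector \<Rightarrow> real) \<Rightarrow> bool" where
  "C1_fun \<Phi> \<longleftrightarrow>
     (\<exists>D :: 'a \<Rightarrow> 'a \<Rightarrow>\<^sub>L real.
        (\<forall>x. (\<Phi> has_derivative blinfun_apply (D x)) (at x)) \<and> continuous_on UNIV D)"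

definition energy :: "('a \<Rightarrow> ereal) \<Rightarrow> ('a \<Rightarrow> real) \<Rightarrow> 'a \<Rightarrow> ereal" where
  "energy \<Psi> \<Phi> u = \<Psi> u + ereal (\<Phi> u)"

text \<open>
  In the next two definitions \<open>\<Psi>\<close> is subtracted only at points of its effective domain, so for
  proper \<open>\<Psi>\<close> no expression of the form \<open>\<infinity> - \<infinity>\<close> occurs.
\<close>

definition critical_point ::
    "('a::real_normed_vector \<Rightarrow> ereal) \<Rightarrow> ('a \<Rightarrow> real) \<Rightarrow> 'a \<Rightarrow> bool" where
  "critical_point \<Psi> \<Phi> u \<longleftrightarrow>
     u \<in> eff_domain \<Psi> \<and>
     (\<forall>v. ereal (frechet_derivative \<Phi> (at u) (v - u)) + \<Psi> v - \<Psi> u \<ge> 0)"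

definition palais_smale ::
    "('a::real_normed_vector \<Rightarrow> ereal) \<Rightarrow> ('a \<Rightarrow> real) \<Rightarrow> bool" where
  "palais_smale \<Psi> \<Phi> \<longleftrightarrow>
     (\<forall>(u :: nat \<Rightarrow> 'a) (c' :: real) (\<epsilon> :: nat \<Rightarrow> real).
        (\<forall>n. u n \<in> eff_domain \<Psi>) \<longrightarrow>
        (\<lambda>n. energy \<Psi> \<Phi> (u n)) \<longlonglongrightarrow> ereal c' \<longrightarrow>
        filterlim \<epsilon> (at_right 0) sequentially \<longrightarrow>
        (\<forall>n v. \<Psi> v - \<Psi> (u n) + ereal (frechet_derivative \<Phi> (at (u n)) (v - u n))
                 \<ge> ereal (- \<epsilon> n * norm (v - u n))) \<longrightarrow>
        (\<exists>(r :: nat \<Rightarrow> nat) l. strict_mono r \<and> (u \<circ> r) \<longlonglongrightarrow> l))"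

definition mp_paths :: "'a::real_normed_vector \<Rightarrow> (real \<Rightarrow> 'a) set" where
  "mp_paths e = {\<gamma>. path \<gamma> \<and> pathstart \<gamma> = 0 \<and> pathfinish \<gamma> = e}"

definition mp_level ::
    "('a::real_normed_vector \<Rightarrow> ereal) \<Rightarrow> ('a \<Rightarrow> real) \<Rightarrow> 'a \<Rightarrow> ereal" where
  "mp_level \<Psi> \<Phi> e = (INF \<gamma>\<in>mp_paths e. SUP t\<in>{0..1}. energy \<Psi> \<Phi> (\<gamma> t))"

end

theory Submission
  imports Defs
begin

text \<open>
  Why the theorem holds. Write \<open>I = \<Psi> + \<Phi>\<close> and let \<open>c\<close> be the mountain pass level; the ring
  condition and the segment from \<open>0\<close> to \<open>e\<close> show that \<open>c\<close> is a positive real number. The map \<open>p\<close>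
  fixes \<open>0\<close> and \<open>e\<close> and does not raise the energy, so composing an almost optimal path with \<open>p\<close>
  gives an almost optimal path that runs inside \<open>range p\<close>. Ekeland's principle, applied to
  \<open>\<gamma> \<mapsto> sup (I \<circ> \<gamma>)\<close> on the complete space of paths, replaces this path by one that is uniformly
  close to it and cannot be improved at rate \<open>\<epsilon>\<close>. Such a path contains an almost critical point
  (\<open>nearly_minimal_path_meets_almost_critical_point\<close>), which therefore lies at distance at most \<open>\<epsilon>\<close>
  from \<open>range p\<close>. Letting \<open>\<epsilon>\<close> tend to \<open>0\<close>, the Palais--Smale condition gives a limit; it is critical
  at level \<open>c\<close> (\<open>almost_critical_limit\<close>), and it lies in \<open>range p\<close> because the range of a continuous
  idempotent map is closed. Thus only the approximating paths have to be compatible with \<open>p\<close>, not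
  the deformation.

  The existence of the almost critical point is the heart of the matter. If every point of high
  energy on the path \<open>\<gamma>\<close> admits a descent target \<open>v\<close>, that is, a point for which
  \<open>\<Psi> v - \<Psi> (\<gamma> t) + D (\<gamma> t) (v - \<gamma> t)\<close> is less than \<open>-2 \<epsilon> |v - \<gamma> t|\<close>, then the targets can be
  glued to a continuous function \<open>w\<close> of \<open>t\<close>: the condition on a target is convex because \<open>\<Psi>\<close> is
  convex, and a target for one parameter serves for all nearby ones because \<open>\<Psi>\<close> is lower
  semicontinuous. Moving every \<open>\<gamma> t\<close> a distance at most \<open>s\<close> towards \<open>w t\<close> lowers the supremum of the
  energy by more than \<open>\<epsilon> s\<close>, against the choice of \<open>\<gamma>\<close>.
\<close>

section \<open>Ekeland's variational principle\<close>

text \<open>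
  The relation \<open>F y + \<epsilon> * dist x y \<le> F x\<close> is a partial order on \<open>S\<close>; its lower cones \<open>A x\<close> shrink to
  a point along a sequence that almost minimises \<open>F\<close> in each cone, and that point is minimal. Lower
  semicontinuity of \<open>F\<close> on \<open>S\<close> is expressed by closed sublevel sets, which also makes sense when
  \<open>F\<close> is meaningful on \<open>S\<close> only.
\<close>

lemma ekeland_variational_principle:
  fixes F :: "'x::metric_space \<Rightarrow> real"
  assumes compl: "complete S" and x0: "x0 \<in> S" and eps: "\<epsilon> > 0"
    and bdd: "\<And>x. x \<in> S \<Longrightarrow> b \<le> F x"
    and cl: "\<And>a. closed {x \<in> S. F x \<le> a}"
  obtains x where "x \<in> S" "F x + \<epsilon> * dist x0 x \<le> F x0"
    "\<And>y. y \<in> S \<Longrightarrow> y \<noteq> x \<Longrightarrow> F x < F y + \<epsilon> * dist x y"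
proof -
  define A where "A x = {y \<in> S. F y + \<epsilon> * dist x y \<le> F x}" for x
  have A_self: "x \<in> A x" if "x \<in> S" for x
    using that by (simp add: A_def)
  have A_trans: "z \<in> A x" if "y \<in> A x" "z \<in> A y" for x y z
  proof -
    have "\<epsilon> * dist x z \<le> \<epsilon> * (dist x y + dist y z)"
      using eps by (intro mult_left_mono dist_triangle) auto
    then show ?thesis
      using that by (auto simp: A_def algebra_simps)
  qed
  have bddA: "bdd_below (F ` A x)" for x
    by (rule bdd_belowI[of _ b]) (auto simp: A_def bdd)
  have step: "\<exists>y. y \<in> A x \<and> F y \<le> Inf (F ` A x) + (1/2) ^ n" if "x \<in> S" for x and n :: nat
  proof -
    have "\<exists>r\<in>F ` A x. r < Inf (F ` A x) + (1/2) ^ n"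
      using A_self[OF that] bddA by (subst cInf_less_iff[symmetric]) auto
    then show ?thesis by (auto intro: less_imp_le)
  qed
  obtain X where X0: "X 0 = x0" and XS: "\<And>n. X n \<in> S"
    and XA: "\<And>n. X (Suc n) \<in> A (X n)"
    and Xinf: "\<And>n. F (X (Suc n)) \<le> Inf (F ` A (X n)) + (1/2) ^ n"
  proof -
    have "\<exists>f. \<forall>n. (f n \<in> S \<and> (n = 0 \<longrightarrow> f n = x0)) \<and>
        (f (Suc n) \<in> A (f n) \<and> F (f (Suc n)) \<le> Inf (F ` A (f n)) + (1/2) ^ n)"
      by (rule dependent_nat_choice) (use x0 step in \<open>auto simp: A_def\<close>)
    then show ?thesis using that by metis
  qed
  have XAm: "X m \<in> A (X n)" if "n \<le> m" for n m
    using that by (induction rule: dec_induct) (auto intro: A_self XS A_trans XA)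
  then have Xdist: "\<epsilon> * dist (X n) (X m) \<le> F (X n) - F (X m)" if "n \<le> m" for n m
    using that by (auto simp: A_def algebra_simps)
  have decF: "decseq (\<lambda>n. F (X n))"
  proof (rule decseq_SucI)
    fix n
    have "0 \<le> \<epsilon> * dist (X n) (X (Suc n))" using eps by simp
    also have "\<dots> \<le> F (X n) - F (X (Suc n))" by (rule Xdist) simp
    finally show "F (X (Suc n)) \<le> F (X n)" by simp
  qed
  then obtain L where L: "(\<lambda>n. F (X n)) \<longlonglongrightarrow> L" and L_le: "\<And>n. L \<le> F (X n)"
    using decseq_convergent[of "\<lambda>n. F (X n)" b] bdd XS by blast
  have "Cauchy X"
  proof (rule metric_CauchyI)
    fix r :: real assume "r > 0"
    then have "\<forall>\<^sub>F n in sequentially. F (X n) < L + \<epsilon> * (r / 2)"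
      using L eps by (intro order_tendstoD(2)) auto
    then obtain N where N: "\<And>n. n \<ge> N \<Longrightarrow> F (X n) < L + \<epsilon> * (r / 2)"
      by (auto simp: eventually_sequentially)
    have *: "dist (X N) (X m) < r / 2" if "N \<le> m" for m
    proof -
      have "\<epsilon> * dist (X N) (X m) < \<epsilon> * (r / 2)"
        using Xdist[OF that] N[of N] L_le[of m] by simp
      then show ?thesis using eps by simp
    qed
    show "\<exists>M. \<forall>m\<ge>M. \<forall>n\<ge>M. dist (X m) (X n) < r"
      using * by (intro exI[of _ N]) (metis dist_commute dist_triangle_half_l)
  qed
  then obtain x where xS: "x \<in> S" and Xx: "X \<longlonglongrightarrow> x"
    using compl XS unfolding complete_def by blast
  have FxL: "F x \<le> L"
  proof (rule dense_ge)
    fix a assume "L < a"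
    then have "\<forall>\<^sub>F n in sequentially. X n \<in> {x \<in> S. F x \<le> a}"
      using eventually_mono[OF order_tendstoD(2)[OF L \<open>L < a\<close>]] XS by (simp add: less_imp_le)
    then have "x \<in> {x \<in> S. F x \<le> a}"
      using Lim_in_closed_set[OF cl _ _ Xx] by simp
    then show "F x \<le> a" by simp
  qed
  have xA: "x \<in> A (X n)" for n
  proof -
    have "(\<lambda>m. \<epsilon> * dist (X n) (X m)) \<longlonglongrightarrow> \<epsilon> * dist (X n) x"
      by (intro tendsto_intros Xx)
    moreover have "(\<lambda>m. F (X n) - F (X m)) \<longlonglongrightarrow> F (X n) - L"
      by (intro tendsto_intros L)
    ultimately have "\<epsilon> * dist (X n) x \<le> F (X n) - L"
      by (rule LIMSEQ_le) (use Xdist in blast)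
    then show ?thesis using FxL xS by (simp add: A_def)
  qed
  show thesis
  proof (rule that)
    show "x \<in> S" by fact
    show "F x + \<epsilon> * dist x0 x \<le> F x0" using xA[of 0] by (simp add: A_def X0)
    fix y assume y: "y \<in> S" "y \<noteq> x"
    show "F x < F y + \<epsilon> * dist x y"
    proof (rule ccontr)
      assume "\<not> ?thesis"
      then have "y \<in> A x" using y by (simp add: A_def)
      then have yA: "y \<in> A (X n)" for n using xA A_trans by blast
      have bound: "\<epsilon> * dist (X (Suc n)) y \<le> (1/2) ^ n" for n
      proof -
        have "Inf (F ` A (X n)) \<le> F y"
          by (intro cInf_lower bddA imageI yA)
        then show ?thesis using yA[of "Suc n"] Xinf[of n] by (simp add: A_def)
      qed
      have "(\<lambda>n. \<epsilon> * dist (X (Suc n)) y) \<longlonglongrightarrow> \<epsilon> * dist x y"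
        by (intro tendsto_intros LIMSEQ_Suc Xx)
      moreover have "(\<lambda>n. (1/2::real) ^ n) \<longlonglongrightarrow> 0"
        by (rule LIMSEQ_power_zero) simp
      ultimately have "\<epsilon> * dist x y \<le> 0"
        by (rule LIMSEQ_le) (use bound in blast)
      then show False using eps y(2) by (simp add: mult_le_0_iff)
    qed
  qed
qed

section \<open>Gluing local choices from convex sets\<close>

text \<open>
  Local constant choices are averaged by a partition of unity, built from the tent functions
  \<open>max 0 (d s - dist t s)\<close> of a finite subcover. The average at \<open>t\<close> only involves
  constants that are admissible at \<open>t\<close>, so it is admissible by convexity.
\<close>

lemma continuous_selection_of_convex_sets:
  fixes P :: "'t::metric_space \<Rightarrow> 'b::real_normed_vector \<Rightarrow> bool"
  assumes T: "compact T"
    and conv: "\<And>t. t \<in> T \<Longrightarrow> convex {b. P t b}"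
    and loc: "\<And>s. s \<in> T \<Longrightarrow> \<exists>b. \<forall>\<^sub>F t in nhds s. t \<in> T \<longrightarrow> P t b"
  obtains g where "continuous_on T g" "\<And>t. t \<in> T \<Longrightarrow> P t (g t)"
proof -
  have "\<exists>b d. d > 0 \<and> (\<forall>t\<in>T. dist t s < d \<longrightarrow> P t b)" if "s \<in> T" for s
    using loc[OF that] unfolding eventually_nhds_metric by blast
  then obtain b d where d: "\<And>s. s \<in> T \<Longrightarrow> d s > 0"
    and b: "\<And>s t. s \<in> T \<Longrightarrow> t \<in> T \<Longrightarrow> dist t s < d s \<Longrightarrow> P t (b s)"
    by metis
  obtain C where C: "C \<subseteq> T" "finite C" "T \<subseteq> (\<Union>s\<in>C. ball s (d s))"
    by (rule compactE_image[OF T, of T "\<lambda>s. ball s (d s)"]) (use d in auto)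
  define \<mu> where "\<mu> s t = max 0 (d s - dist t s)" for s t
  define L where "L t = (\<Sum>s\<in>C. \<mu> s t)" for t
  define g where "g t = (\<Sum>s\<in>C. (\<mu> s t / L t) *\<^sub>R b s)" for t
  have \<mu>0: "\<mu> s t \<ge> 0" for s t by (simp add: \<mu>_def)
  have Lpos: "L t > 0" if t: "t \<in> T" for t
  proof -
    obtain s where "s \<in> C" "t \<in> ball s (d s)" using C(3) t by blast
    then have "s \<in> C" "dist t s < d s" by (auto simp: dist_commute)
    then show ?thesis unfolding L_def
      by (intro sum_pos2[of _ s] C \<mu>0) (auto simp: \<mu>_def)
  qed
  show thesis
  proof
    have c\<mu>: "continuous_on T (\<mu> s)" for s
      unfolding \<mu>_def by (intro continuous_intros)
    have "continuous_on T L"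
      unfolding L_def by (intro continuous_intros c\<mu>)
    then show "continuous_on T g"
      unfolding g_def using Lpos by (intro continuous_intros c\<mu>) force+
    fix t assume t: "t \<in> T"
    define C' where "C' = {s \<in> C. \<mu> s t \<noteq> 0}"
    have *: "g t = (\<Sum>s\<in>C'. (\<mu> s t / L t) *\<^sub>R b s)"
      unfolding g_def C'_def by (intro sum.mono_neutral_right C) auto
    have "L t = (\<Sum>s\<in>C'. \<mu> s t)"
      unfolding L_def C'_def by (intro sum.mono_neutral_right C) auto
    then have 1: "(\<Sum>s\<in>C'. \<mu> s t / L t) = 1"
      using Lpos[OF t] by (simp flip: sum_divide_distrib)
    have "b s \<in> {b. P t b}" if "s \<in> C'" for s
      using that C(1) t by (auto simp: C'_def \<mu>_def max_def split: if_splits intro!: b)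
    then have "g t \<in> {b. P t b}"
      unfolding * using 1 C(2) Lpos[OF t] \<mu>0
      by (intro convex_sum conv t) (auto simp: C'_def)
    then show "P t (g t)" by simp
  qed
qed

section \<open>Convex, lower semicontinuous and continuously differentiable functions\<close>

lemma convex_fun_epigraph:
  assumes "convex_fun \<Psi>" "\<Psi> x \<le> ereal a" "\<Psi> y \<le> ereal b"
    and uv: "0 \<le> u" "0 \<le> v" "u + v = 1"
  shows "\<Psi> (u *\<^sub>R x + v *\<^sub>R y) \<le> ereal (u * a + v * b)"
proof (cases "u = 0 \<or> v = 0")
  case True
  then show ?thesis using assms by auto
next
  case False
  then have v: "v \<in> {0<..<1}" and u: "u = 1 - v" using uv by auto
  have "\<Psi> (u *\<^sub>R x + v *\<^sub>R y) \<le> ereal u * \<Psi> x + ereal v * \<Psi> y"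
    using assms(1) v unfolding convex_fun_def u by blast
  also have "\<dots> \<le> ereal u * ereal a + ereal v * ereal b"
    using assms by (intro add_mono ereal_mult_left_mono) auto
  finally show ?thesis by simp
qed

lemma closed_energy_le:
  fixes \<Psi> :: "'a::real_normed_vector \<Rightarrow> ereal"
  assumes "lower_semicont \<Psi>" and "continuous_on UNIV \<Phi>"
  shows "closed {x. energy \<Psi> \<Phi> x \<le> ereal a}"
proof -
  have "\<exists>U. open U \<and> x \<in> U \<and> U \<subseteq> - {x. energy \<Psi> \<Phi> x \<le> ereal a}"
    if "\<not> energy \<Psi> \<Phi> x \<le> ereal a" for x
  proof -
    have "ereal (a - \<Phi> x) < \<Psi> x"
      using that by (cases "\<Psi> x") (auto simp: energy_def)
    then obtain r where r: "ereal (a - \<Phi> x) < ereal r" "ereal r < \<Psi> x"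
      using ereal_dense2 by blast
    have "\<forall>\<^sub>F y in nhds x. ereal r < \<Psi> y"
      using assms(1) r(2) by (simp add: lower_semicont_def)
    moreover have "(\<Phi> \<longlongrightarrow> \<Phi> x) (nhds x)"
      using assms(2) by (simp add: continuous_on_eq_continuous_at isCont_def tendsto_at_iff_tendsto_nhds)
    then have "\<forall>\<^sub>F y in nhds x. a - r < \<Phi> y"
      using r(1) by (intro order_tendstoD(1)) auto
    ultimately have "\<forall>\<^sub>F y in nhds x. y \<in> - {x. energy \<Psi> \<Phi> x \<le> ereal a}"
    proof eventually_elim
      case (elim y)
      then show ?case by (cases "\<Psi> y") (auto simp: energy_def)
    qed
    then show ?thesis unfolding eventually_nhds by blast
  qed
  then show ?thesis
    unfolding closed_def by (subst open_subopen) auto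
qed

text \<open>
  A continuous derivative is uniformly continuous near a compact set, although the neighbourhoods of
  that set need not be compact in infinite dimension.
\<close>

lemma uniform_linearization_on_compact:
  fixes \<Phi> :: "'a::real_normed_vector \<Rightarrow> real" and D :: "'a \<Rightarrow> 'a \<Rightarrow>\<^sub>L real"
  assumes D: "\<And>x. (\<Phi> has_derivative blinfun_apply (D x)) (at x)"
    and contD: "continuous_on UNIV D" and K: "compact K" and eps: "\<epsilon> > 0"
  obtains r where "r > 0"
    "\<And>x h. x \<in> K \<Longrightarrow> norm h < r \<Longrightarrow> \<bar>\<Phi> (x + h) - \<Phi> x - D x h\<bar> \<le> \<epsilon> * norm h"
proof -
  define G where "G x = D -` ball (D x) (\<epsilon>/2)" for x
  have "open (G x)" for x
    unfolding G_def using contD by (simp add: continuous_on_open_vimage)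
  moreover have "x \<in> G x" for x using eps by (simp add: G_def)
  ultimately have "K \<subseteq> \<Union>(range G)" "\<And>U. U \<in> range G \<Longrightarrow> open U" by blast+
  from Heine_Borel_lemma[OF K this]
  obtain r where r: "r > 0" "\<And>x. x \<in> K \<Longrightarrow> \<exists>y. ball x r \<subseteq> G y"
    by (metis rangeE)
  show thesis
  proof (rule that[OF r(1)])
    fix x h assume x: "x \<in> K" and h: "norm (h::'a) < r"
    obtain y where y: "ball x r \<subseteq> G y" using r(2)[OF x] by blast
    have near: "norm (D z - D x) \<le> \<epsilon>" if "z \<in> ball x r" for z
    proof -
      have "dist (D y) (D z) < \<epsilon>/2" "dist (D y) (D x) < \<epsilon>/2"
        using y that r(1) by (auto simp: G_def subset_eq)
      then have "dist (D z) (D x) < \<epsilon>"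
        by (metis dist_commute dist_triangle_half_l)
      then show ?thesis by (simp add: dist_norm)
    qed
    have "norm (\<Phi> (x + h) - \<Phi> x - D x ((x + h) - x)) \<le> norm ((x + h) - x) * \<epsilon>"
    proof (rule differentiable_bound_linearization[where S = "ball x r"])
      fix t :: real assume t: "t \<in> {0..1}"
      have "norm (t *\<^sub>R h) \<le> norm h" using t by (simp add: mult_left_le_one_le)
      then show "x + t *\<^sub>R (x + h - x) \<in> ball x r" using h by (simp add: dist_norm)
    next
      fix z assume "z \<in> ball x r"
      then show "onorm (blinfun_apply (D z) - blinfun_apply (D x)) \<le> \<epsilon>"
        using near[of z] by (simp add: norm_blinfun.rep_eq minus_blinfun.rep_eq fun_diff_def)
    qed (use r(1) in \<open>auto intro: has_derivative_at_withinI[OF D]\<close>)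
    then show "\<bar>\<Phi> (x + h) - \<Phi> x - D x h\<bar> \<le> \<epsilon> * norm h"
      by (simp add: mult.commute)
  qed
qed

section \<open>Limits of almost critical points\<close>

text \<open>
  Since \<open>\<Psi>\<close> is only lower semicontinuous, \<open>I (x n) \<longlonglongrightarrow> c\<close> alone gives just \<open>I u \<le> c\<close>. The missing
  inequality comes from testing almost criticality with \<open>v = u\<close>.
\<close>

lemma almost_critical_limit:
  fixes \<Psi> :: "'a::real_normed_vector \<Rightarrow> ereal" and D :: "'a \<Rightarrow> 'a \<Rightarrow>\<^sub>L real"
  assumes lsc: "lower_semicont \<Psi>" and proper: "\<And>x. \<Psi> x \<noteq> -\<infinity>"
    and cont\<Phi>: "continuous_on UNIV \<Phi>" and contD: "continuous_on UNIV D"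
    and dom: "\<And>n. x n \<in> eff_domain \<Psi>"
    and x: "x \<longlonglongrightarrow> u" and lev: "(\<lambda>n. energy \<Psi> \<Phi> (x n)) \<longlonglongrightarrow> ereal c"
    and \<epsilon>: "\<epsilon> \<longlonglongrightarrow> 0"
    and ps: "\<And>n v. ereal (- \<epsilon> n * norm (v - x n)) \<le> \<Psi> v - \<Psi> (x n) + ereal (D (x n) (v - x n))"
  shows "energy \<Psi> \<Phi> u = ereal c" "u \<in> eff_domain \<Psi>"
    "\<And>v. 0 \<le> ereal (D u (v - u)) + \<Psi> v - \<Psi> u"
proof -
  define b where "b n = real_of_ereal (\<Psi> (x n))" for n
  have b: "\<Psi> (x n) = ereal (b n)" for n
    using dom[of n] proper[of "x n"] by (auto simp: b_def eff_domain_def ereal_real)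
  define L where "L = c - \<Phi> u"
  have \<Phi>x: "(\<lambda>n. \<Phi> (x n)) \<longlonglongrightarrow> \<Phi> u"
    using continuous_on_tendsto_compose[OF cont\<Phi> x] by simp
  have Dx: "(\<lambda>n. D (x n)) \<longlonglongrightarrow> D u"
    using continuous_on_tendsto_compose[OF contD x] by simp
  have "(\<lambda>n. b n + \<Phi> (x n)) \<longlonglongrightarrow> c"
    using lev by (simp add: energy_def b)
  from tendsto_diff[OF this \<Phi>x] have bL: "b \<longlonglongrightarrow> L"
    by (simp add: L_def)
  have upper: "\<Psi> u \<le> ereal L"
  proof (rule ccontr)
    assume "\<not> ?thesis"
    then have "ereal L < \<Psi> u" by simp
    then obtain r where r: "ereal L < ereal r" "ereal r < \<Psi> u"
      using ereal_dense2 by blast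
    have "\<forall>\<^sub>F y in nhds u. ereal r < \<Psi> y"
      using lsc r(2) by (simp add: lower_semicont_def)
    then have "\<forall>\<^sub>F n in sequentially. ereal r < \<Psi> (x n)"
      using x by (rule eventually_compose_filterlim)
    moreover have "\<forall>\<^sub>F n in sequentially. b n < r"
      using order_tendstoD(2)[OF bL] r(1) by simp
    ultimately have "\<forall>\<^sub>F n in sequentially. False"
      by eventually_elim (simp add: b)
    then show False by simp
  qed
  have lower: "L \<le> z + D u (v - u)" if z: "\<Psi> v = ereal z" for v z
  proof -
    have "(\<lambda>n. - \<epsilon> n * norm (v - x n)) \<longlonglongrightarrow> - 0 * norm (v - u)"
      by (intro tendsto_intros x \<epsilon>)
    moreover have "(\<lambda>n. z - b n + D (x n) (v - x n)) \<longlonglongrightarrow> z - L + D u (v - u)"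
      by (intro tendsto_intros x bL Dx)
    ultimately have "- 0 * norm (v - u) \<le> z - L + D u (v - u)"
      by (rule LIMSEQ_le) (use ps[of _ v] in \<open>simp add: z b\<close>)
    then show ?thesis by simp
  qed
  obtain z where z: "\<Psi> u = ereal z"
    using upper proper[of u] by (cases "\<Psi> u") auto
  have zL: "z = L" using lower[OF z] upper z by (simp add: blinfun.zero_right)
  show "energy \<Psi> \<Phi> u = ereal c" by (simp add: energy_def z zL L_def)
  show "u \<in> eff_domain \<Psi>" by (simp add: eff_domain_def z)
  show "0 \<le> ereal (D u (v - u)) + \<Psi> v - \<Psi> u" for v
    using lower[of v] proper[of v] by (cases "\<Psi> v") (auto simp: z zL)
qed

section \<open>Almost critical points on nearly minimal paths\<close>

text \<open>
  The assumption \<open>mini\<close> is what Ekeland's principle provides: displacing the path by at most \<open>s\<close>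
  cannot lower the supremum of the energy by more than \<open>\<epsilon> * s\<close>. The factor \<open>2\<close> in the conclusion
  leaves room for the linearisation error of \<open>\<Phi>\<close> in the deformation.

  A target \<open>w\<close> at \<open>t\<close> is selected together with real numbers \<open>y\<close> and \<open>n\<close> bounding \<open>\<Psi> w\<close> and
  \<open>norm (w - \<gamma> t)\<close>. Passing to these upper bounds turns the requirements \<open>Q\<close> below into
  convex conditions on the triple and makes \<open>y\<close> and \<open>n\<close> continuous, hence bounded, although
  \<open>\<Psi> (w t)\<close> need not be continuous. Positivity of \<open>n\<close> allows the step fraction \<open>s / n t\<close>
  even where \<open>w t = \<gamma> t\<close>.
\<close>

lemma nearly_minimal_path_meets_almost_critical_point:
  fixes \<Psi> :: "'a::real_normed_vector \<Rightarrow> ereal" and D :: "'a \<Rightarrow> 'a \<Rightarrow>\<^sub>L real"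
    and \<gamma> :: "real \<Rightarrow> 'a"
  assumes conv: "convex_fun \<Psi>" and lsc: "lower_semicont \<Psi>" and proper: "\<And>x. \<Psi> x \<noteq> -\<infinity>"
    and D: "\<And>x. (\<Phi> has_derivative blinfun_apply (D x)) (at x)"
    and contD: "continuous_on UNIV D"
    and \<gamma>: "continuous_on UNIV \<gamma>"
    and le: "\<And>t. t \<in> {0..1} \<Longrightarrow> energy \<Psi> \<Phi> (\<gamma> t) \<le> ereal M"
    and ends: "energy \<Psi> \<Phi> (\<gamma> 0) < ereal (M - \<delta>)" "energy \<Psi> \<Phi> (\<gamma> 1) < ereal (M - \<delta>)"
    and eps: "\<epsilon> > 0" and delta: "\<delta> > 0"
    and mini: "\<And>\<eta> s. path \<eta> \<Longrightarrow> \<eta> 0 = \<gamma> 0 \<Longrightarrow> \<eta> 1 = \<gamma> 1 \<Longrightarrow> s > 0 \<Longrightarrow>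
      (\<And>t. t \<in> {0..1} \<Longrightarrow> norm (\<eta> t - \<gamma> t) \<le> s) \<Longrightarrow>
      ereal (M - \<epsilon> * s) \<le> (SUP t\<in>{0..1}. energy \<Psi> \<Phi> (\<eta> t))"
  shows "\<exists>t\<in>{0..1}. ereal (M - \<delta>) \<le> energy \<Psi> \<Phi> (\<gamma> t) \<and>
    (\<forall>v. ereal (- (2 * \<epsilon>) * norm (v - \<gamma> t)) \<le> \<Psi> v - \<Psi> (\<gamma> t) + ereal (D (\<gamma> t) (v - \<gamma> t)))"
proof (rule ccontr)
  assume "\<not> ?thesis"
  then have descent: "\<exists>v. \<Psi> v - \<Psi> (\<gamma> t) + ereal (D (\<gamma> t) (v - \<gamma> t)) < ereal (- (2 * \<epsilon>) * norm (v - \<gamma> t))"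
    if "t \<in> {0..1}" "ereal (M - \<delta>) \<le> energy \<Psi> \<Phi> (\<gamma> t)" for t
    using that by (meson not_le)
  define a where "a t = real_of_ereal (\<Psi> (\<gamma> t))" for t
  define \<phi> where "\<phi> t = \<Phi> (\<gamma> t)" for t
  have a: "\<Psi> (\<gamma> t) = ereal (a t)" if "t \<in> {0..1}" for t
    using le[OF that] proper[of "\<gamma> t"] unfolding a_def energy_def
    by (cases "\<Psi> (\<gamma> t)") auto
  have I: "energy \<Psi> \<Phi> (\<gamma> t) = ereal (a t + \<phi> t)" if "t \<in> {0..1}" for t
    by (simp add: energy_def a[OF that] \<phi>_def)
  have cont\<Phi>: "continuous_on UNIV \<Phi>"
    using D by (intro continuous_at_imp_continuous_on) (auto intro: has_derivative_continuous)
  have c\<phi>: "continuous_on T \<phi>" for T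
    unfolding \<phi>_def using continuous_on_compose2[OF cont\<Phi> \<gamma>] continuous_on_subset by blast
  have cD\<gamma>: "continuous_on T (\<lambda>t. D (\<gamma> t))" for T
    using continuous_on_compose2[OF contD \<gamma>] continuous_on_subset by blast
  have c\<gamma>: "continuous_on T \<gamma>" for T
    using \<gamma> continuous_on_subset by blast
  have ev: "\<forall>\<^sub>F t in nhds s. h t < r"
    if "continuous_on UNIV h" "h s < r" for h :: "real \<Rightarrow> real" and s r
    using that by (intro order_tendstoD(2)[of h "h s"])
      (simp_all add: continuous_on_eq_continuous_at isCont_def tendsto_at_iff_tendsto_nhds)
  have ev_a: "\<forall>\<^sub>F t in nhds s. t \<in> {0..1} \<longrightarrow> r < a t"
    if "s \<in> {0..1}" "r < a s" for s r
  proof -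
    have "\<forall>\<^sub>F x in nhds (\<gamma> s). ereal r < \<Psi> x"
      using lsc that a[of s] by (simp add: lower_semicont_def)
    moreover have "filterlim \<gamma> (nhds (\<gamma> s)) (nhds s)"
      using \<gamma> by (simp add: continuous_on_eq_continuous_at isCont_def tendsto_at_iff_tendsto_nhds)
    ultimately have "\<forall>\<^sub>F t in nhds s. ereal r < \<Psi> (\<gamma> t)"
      by (rule eventually_compose_filterlim)
    then show ?thesis by eventually_elim (use a in force)
  qed
  \<comment> \<open>Descent is required from level \<open>M - \<delta>/2\<close> on, but is given by assumption from \<open>M - \<delta>\<close> on. The
    gap between the two levels is what makes the target \<open>w = \<gamma> s\<close> work around a low point \<open>\<gamma> s\<close>.\<close>
  define Q where "Q t w y n \<longleftrightarrow> \<Psi> w \<le> ereal y \<and> 0 < n \<and> norm (w - \<gamma> t) \<le> n \<and>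
      (M - \<delta>/2 \<le> a t + \<phi> t \<longrightarrow> y - a t + D (\<gamma> t) (w - \<gamma> t) \<le> - 2 * \<epsilon> * n) \<and>
      (t \<in> {0, 1} \<longrightarrow> w = \<gamma> t)" for t w y n
  have Q_convex: "convex {b. Q t (fst b) (fst (snd b)) (snd (snd b))}" for t
  proof (rule convexI)
    fix b b' :: "'a \<times> real \<times> real" and u v :: real
    assume uv: "0 \<le> u" "0 \<le> v" "u + v = 1"
    obtain w y n w' y' n' where bb: "b = (w, y, n)" "b' = (w', y', n')"
      by (metis prod.exhaust)
    assume "b \<in> {b. Q t (fst b) (fst (snd b)) (snd (snd b))}"
      "b' \<in> {b. Q t (fst b) (fst (snd b)) (snd (snd b))}"
    then have q: "Q t w y n" "Q t w' y' n'" by (auto simp: bb)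
    let ?w = "u *\<^sub>R w + v *\<^sub>R w'"
    have "\<gamma> t = u *\<^sub>R \<gamma> t + v *\<^sub>R \<gamma> t"
      using uv by (metis scaleR_add_left scaleR_one)
    then have w: "?w - \<gamma> t = u *\<^sub>R (w - \<gamma> t) + v *\<^sub>R (w' - \<gamma> t)"
      by (simp add: algebra_simps)
    have "Q t ?w (u * y + v * y') (u * n + v * n')"
      unfolding Q_def
    proof (intro conjI impI)
      show "\<Psi> ?w \<le> ereal (u * y + v * y')"
        using q uv by (intro convex_fun_epigraph conv) (auto simp: Q_def)
      have "u > 0 \<or> v > 0" using uv by linarith
      moreover have "n > 0" "n' > 0" using q by (auto simp: Q_def)
      ultimately show "0 < u * n + v * n'"
        using uv by (elim disjE) (simp_all add: add_pos_nonneg add_nonneg_pos)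
      have "norm (?w - \<gamma> t) \<le> u * norm (w - \<gamma> t) + v * norm (w' - \<gamma> t)"
        unfolding w using uv by (intro norm_triangle_le) simp
      also have "\<dots> \<le> u * n + v * n'"
        using q uv by (intro add_mono mult_left_mono) (auto simp: Q_def)
      finally show "norm (?w - \<gamma> t) \<le> u * n + v * n'" .
    next
      assume hi: "M - \<delta>/2 \<le> a t + \<phi> t"
      have "u * (y - a t + D (\<gamma> t) (w - \<gamma> t)) + v * (y' - a t + D (\<gamma> t) (w' - \<gamma> t))
          \<le> u * (- 2 * \<epsilon> * n) + v * (- 2 * \<epsilon> * n')"
        using q uv hi by (intro add_mono mult_left_mono) (auto simp: Q_def)
      moreover have "u * (y - a t + D (\<gamma> t) (w - \<gamma> t)) + v * (y' - a t + D (\<gamma> t) (w' - \<gamma> t))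
          = u * y + v * y' - (u + v) * a t + D (\<gamma> t) (?w - \<gamma> t)"
      proof -
        have "D (\<gamma> t) (?w - \<gamma> t) = u * D (\<gamma> t) (w - \<gamma> t) + v * D (\<gamma> t) (w' - \<gamma> t)"
          unfolding w by (simp add: blinfun.add_right blinfun.scaleR_right)
        then show ?thesis by (simp only: algebra_simps)
      qed
      ultimately show "u * y + v * y' - a t + D (\<gamma> t) (?w - \<gamma> t) \<le> - 2 * \<epsilon> * (u * n + v * n')"
        using uv by (simp add: algebra_simps)
    next
      assume "t \<in> {0, 1}"
      then have "w = \<gamma> t" "w' = \<gamma> t" using q by (auto simp: Q_def)
      then show "?w = \<gamma> t" using w by simp
    qed
    then show "u *\<^sub>R b + v *\<^sub>R b' \<in> {b. Q t (fst b) (fst (snd b)) (snd (snd b))}"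
      by (simp add: bb)
  qed
  have Q_local: "\<exists>w y n. \<forall>\<^sub>F t in nhds s. t \<in> {0..1} \<longrightarrow> Q t w y n" if s: "s \<in> {0..1}" for s
  proof (cases "M - \<delta> \<le> a s + \<phi> s")
    case True
    have "s \<noteq> 0" "s \<noteq> 1" using True ends I[of 0] I[of 1] by auto
    then have "s \<in> {0<..<1}" using s by auto
    then have ev01: "\<forall>\<^sub>F t in nhds s. t \<in> {0<..<1}"
      by (intro eventually_nhds_in_open) auto
    obtain v where v: "\<Psi> v - \<Psi> (\<gamma> s) + ereal (D (\<gamma> s) (v - \<gamma> s)) < ereal (- (2 * \<epsilon>) * norm (v - \<gamma> s))"
      using descent[OF s] True by (auto simp: I[OF s])
    then obtain y where y: "\<Psi> v = ereal y"
      using proper[of v] by (cases "\<Psi> v") (auto simp: a[OF s])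
    \<comment> \<open>The slack \<open>g\<close> in the strict descent inequality is spent on enlarging \<open>n\<close>, and the remaining
      inequality is strict, so it persists near \<open>s\<close>.\<close>
    define g where "g = - 2 * \<epsilon> * norm (v - \<gamma> s) - (y - a s + D (\<gamma> s) (v - \<gamma> s))"
    have g: "g > 0" using v by (simp add: y a[OF s] g_def)
    define n where "n = norm (v - \<gamma> s) + g / (4 * \<epsilon>)"
    have n: "norm (v - \<gamma> s) < n" using g eps by (simp add: n_def)
    have "y + D (\<gamma> s) (v - \<gamma> s) + 2 * \<epsilon> * n = a s - g / 2"
      using eps by (simp add: n_def g_def field_simps)
    then have "\<forall>\<^sub>F t in nhds s. y + D (\<gamma> t) (v - \<gamma> t) + 2 * \<epsilon> * n < a s - g / 4"
      using g by (intro ev continuous_intros cD\<gamma> \<gamma>) auto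
    moreover have "\<forall>\<^sub>F t in nhds s. t \<in> {0..1} \<longrightarrow> a s - g / 4 < a t"
      using g by (intro ev_a s) auto
    moreover have "\<forall>\<^sub>F t in nhds s. norm (v - \<gamma> t) < n"
      using n by (intro ev continuous_intros \<gamma>) auto
    ultimately have "\<forall>\<^sub>F t in nhds s. t \<in> {0..1} \<longrightarrow> Q t v y n"
      using ev01
    proof eventually_elim
      case (elim t)
      show ?case
      proof
        assume "t \<in> {0..1}"
        with elim(2) have "a s - g / 4 < a t" by blast
        moreover have "0 < n" using n norm_ge_zero[of "v - \<gamma> s"] by linarith
        ultimately show "Q t v y n" using elim(1,3,4) by (auto simp: Q_def y)
      qed
    qed
    then show ?thesis by blast
  next
    case False
    \<comment> \<open>The energy may jump upwards near \<open>s\<close>; at a high point \<open>\<gamma> t\<close> close to \<open>\<gamma> s\<close> the target \<open>\<gamma> s\<close>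
      lowers \<open>\<Psi>\<close> by more than \<open>\<delta> / 4\<close> over a negligible distance.\<close>
    define n where "n = \<delta> / (8 * \<epsilon>)"
    have n: "n > 0" using eps delta by (simp add: n_def)
    have "\<forall>\<^sub>F t in nhds s. norm (\<gamma> s - \<gamma> t) < n"
      using n by (intro ev continuous_intros \<gamma>) auto
    moreover have "\<forall>\<^sub>F t in nhds s. \<phi> t - \<phi> s < \<delta> / 8"
      using delta by (intro ev continuous_intros c\<phi>) auto
    moreover have "\<forall>\<^sub>F t in nhds s. D (\<gamma> t) (\<gamma> s - \<gamma> t) < \<delta> / 8"
      using delta by (intro ev continuous_intros cD\<gamma> \<gamma>) (auto simp: blinfun.zero_right)
    moreover have "\<forall>\<^sub>F t in nhds s. t \<noteq> s \<longrightarrow> t \<notin> {0, 1}"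
    proof -
      have "\<forall>\<^sub>F t in nhds s. t \<in> - ({0, 1} - {s})"
        by (intro eventually_nhds_in_open open_Compl finite_imp_closed) auto
      then show ?thesis by eventually_elim auto
    qed
    ultimately have "\<forall>\<^sub>F t in nhds s. t \<in> {0..1} \<longrightarrow> Q t (\<gamma> s) (a s) n"
    proof eventually_elim
      case (elim t)
      have "a s - a t + D (\<gamma> t) (\<gamma> s - \<gamma> t) \<le> - 2 * \<epsilon> * n" if "M - \<delta>/2 \<le> a t + \<phi> t"
      proof -
        have "- 2 * \<epsilon> * n = - \<delta> / 4" using eps by (simp add: n_def)
        then show ?thesis using elim False that by simp
      qed
      then show ?case
        using elim n by (auto simp: Q_def a[OF s])
    qed
    then show ?thesis by blast
  qed
  have "\<exists>b. \<forall>\<^sub>F t in nhds s. t \<in> {0..1} \<longrightarrow> Q t (fst b) (fst (snd b)) (snd (snd b))"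
    if "s \<in> {0..1}" for s
    using Q_local[OF that] by (metis fst_conv snd_conv)
  then obtain b where cb: "continuous_on {0..1} b"
    and b: "\<And>t. t \<in> {0..1} \<Longrightarrow> Q t (fst (b t)) (fst (snd (b t))) (snd (snd (b t)))"
    using continuous_selection_of_convex_sets[of "{0..1::real}"
        "\<lambda>t b. Q t (fst b) (fst (snd b)) (snd (snd b))"] Q_convex by auto
  define w y n where "w t = fst (b t)" and "y t = fst (snd (b t))" and "n t = snd (snd (b t))" for t
  have cw: "continuous_on {0..1} w" and cy: "continuous_on {0..1} y" and cn: "continuous_on {0..1} n"
    unfolding w_def y_def n_def by (intro continuous_intros cb)+
  have Q: "Q t (w t) (y t) (n t)" if "t \<in> {0..1}" for t
    using b[OF that] by (simp add: w_def y_def n_def)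
  obtain m where m: "m > 0" "\<And>t. t \<in> {0..1} \<Longrightarrow> m \<le> n t"
  proof -
    obtain t where "t \<in> {0..1}" "\<forall>t'\<in>{0..1}. n t \<le> n t'"
      using continuous_attains_inf[OF _ _ cn] by auto
    then show ?thesis using Q[of t] by (intro that[of "n t"]) (auto simp: Q_def)
  qed
  \<comment> \<open>At low points nothing is known about descent; \<open>K\<close> bounds the linearised energy of the target,
    so that a short step keeps the energy well below \<open>M\<close> there.\<close>
  obtain K where K: "K \<ge> M" "\<And>t. t \<in> {0..1} \<Longrightarrow> y t + \<phi> t + D (\<gamma> t) (w t - \<gamma> t) \<le> K"
  proof -
    have "continuous_on {0..1} (\<lambda>t. y t + \<phi> t + D (\<gamma> t) (w t - \<gamma> t))"
      by (intro continuous_intros cy c\<phi> cD\<gamma> cw c\<gamma>)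
    then obtain t where "\<forall>t'\<in>{0..1}. y t' + \<phi> t' + D (\<gamma> t') (w t' - \<gamma> t') \<le> y t + \<phi> t + D (\<gamma> t) (w t - \<gamma> t)"
      using continuous_attains_sup[of "{0..1::real}"] by fastforce
    then show ?thesis
      by (intro that[of "max M (y t + \<phi> t + D (\<gamma> t) (w t - \<gamma> t))"]) (auto simp: le_max_iff_disj)
  qed
  have "compact (\<gamma> ` {0..1})" by (intro compact_continuous_image c\<gamma>) auto
  then obtain r where r: "r > 0"
    "\<And>x h. x \<in> \<gamma> ` {0..1} \<Longrightarrow> norm h < r \<Longrightarrow> \<bar>\<Phi> (x + h) - \<Phi> x - D x h\<bar> \<le> \<epsilon> / 2 * norm h"
    using uniform_linearization_on_compact[OF D contD, of "\<gamma> ` {0..1}" "\<epsilon>/2"] eps by auto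
  define B where "B = (K - M + \<delta>/2) / m + 2 * \<epsilon>"
  have B: "B > 0" using K(1) m(1) delta eps by (auto simp: B_def intro!: add_nonneg_pos divide_nonneg_pos)
  define s where "s = min (r / 2) (min m (\<delta> / 2 / B))"
  have s: "s > 0" "s < r" "s \<le> m" "s \<le> \<delta> / 2 / B"
    using r(1) m(1) delta B by (auto simp: s_def)
  have sB: "s * B \<le> \<delta> / 2" using s(4) B by (simp add: pos_le_divide_eq)
  define \<eta> where "\<eta> t = \<gamma> t + (s / n t) *\<^sub>R (w t - \<gamma> t)" for t
  have np: "n t > 0" if "t \<in> {0..1}" for t using m(1) m(2)[OF that] by linarith
  have \<eta>_near: "norm ((s / n t) *\<^sub>R (w t - \<gamma> t)) \<le> s" if t: "t \<in> {0..1}" for t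
  proof -
    have "norm (w t - \<gamma> t) \<le> n t" using Q[OF t] by (simp add: Q_def)
    then have "s * norm (w t - \<gamma> t) \<le> s * n t" using s(1) by simp
    moreover have "norm ((s / n t) *\<^sub>R (w t - \<gamma> t)) = s * norm (w t - \<gamma> t) / n t"
      using divide_pos_pos[OF s(1) np[OF t]] by (simp only: norm_scaleR real_norm_def abs_of_pos) simp
    ultimately show ?thesis using np[OF t] by (simp only: pos_divide_le_eq)
  qed
  have low: "energy \<Psi> \<Phi> (\<eta> t) \<le> ereal (M - 3/2 * \<epsilon> * s)" if t: "t \<in> {0..1}" for t
  proof -
    define \<kappa> where "\<kappa> = \<epsilon> * s"
    define \<sigma> where "\<sigma> = s / n t"
    have \<sigma>: "0 < \<sigma>" "\<sigma> \<le> 1" "\<sigma> \<le> s / m" "\<sigma> * n t = s"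
      using s np[OF t] m(1) m(2)[OF t] by (auto simp: \<sigma>_def divide_simps)
    let ?h = "\<sigma> *\<^sub>R (w t - \<gamma> t)"
    have \<eta>: "\<eta> t = \<gamma> t + ?h" "\<eta> t = (1 - \<sigma>) *\<^sub>R \<gamma> t + \<sigma> *\<^sub>R w t"
      by (simp_all add: \<eta>_def \<sigma>_def algebra_simps)
    have "\<Psi> (\<eta> t) \<le> ereal ((1 - \<sigma>) * a t + \<sigma> * y t)"
      unfolding \<eta>(2) using \<sigma> Q[OF t] by (intro convex_fun_epigraph conv) (auto simp: a[OF t] Q_def)
    then have 1: "energy \<Psi> \<Phi> (\<eta> t) \<le> ereal ((1 - \<sigma>) * a t + \<sigma> * y t + \<Phi> (\<eta> t))"
      unfolding energy_def by (metis add_right_mono plus_ereal.simps(1))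
    have h: "norm ?h \<le> s" using \<eta>_near[OF t] by (simp add: \<sigma>_def)
    have "\<bar>\<Phi> (\<gamma> t + ?h) - \<Phi> (\<gamma> t) - D (\<gamma> t) ?h\<bar> \<le> \<epsilon> / 2 * norm ?h"
      using h s(2) t by (intro r(2)) auto
    moreover have "\<epsilon> / 2 * norm ?h \<le> \<epsilon> / 2 * s" using h eps by (intro mult_left_mono) auto
    ultimately have "\<bar>\<Phi> (\<gamma> t + ?h) - \<Phi> (\<gamma> t) - D (\<gamma> t) ?h\<bar> \<le> \<epsilon> / 2 * s"
      by (rule order_trans)
    then have "\<Phi> (\<gamma> t + ?h) - \<Phi> (\<gamma> t) - D (\<gamma> t) ?h \<le> \<epsilon> / 2 * s"
      by (rule order_trans[OF abs_ge_self])
    then have 2: "\<Phi> (\<eta> t) \<le> \<phi> t + \<sigma> * D (\<gamma> t) (w t - \<gamma> t) + \<kappa> / 2"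
      by (simp add: \<kappa>_def \<eta>(1) \<phi>_def blinfun.scaleR_right)
    have "(1 - \<sigma>) * a t + \<sigma> * y t + \<Phi> (\<eta> t) \<le> M - 3/2 * \<kappa>"
    proof (cases "M - \<delta>/2 \<le> a t + \<phi> t")
      case True
      then have "\<sigma> * (y t - a t + D (\<gamma> t) (w t - \<gamma> t)) \<le> \<sigma> * (- 2 * \<epsilon> * n t)"
        using Q[OF t] \<sigma>(1) by (intro mult_left_mono) (auto simp: Q_def)
      also have "\<dots> = - 2 * \<epsilon> * (\<sigma> * n t)" by (simp add: ac_simps)
      also have "\<dots> = - 2 * \<kappa>" by (simp add: \<sigma>(4) \<kappa>_def)
      finally have "\<sigma> * (y t - a t + D (\<gamma> t) (w t - \<gamma> t)) \<le> - 2 * \<kappa>" .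
      moreover have "a t + \<phi> t \<le> M" using le[OF t] I[OF t] by simp
      ultimately show ?thesis using 2 by (simp add: algebra_simps)
    next
      case False
      define N where "N = M - \<delta>/2"
      have "(1 - \<sigma>) * (a t + \<phi> t) \<le> (1 - \<sigma>) * N"
        using False \<sigma> by (intro mult_left_mono) (auto simp: N_def)
      moreover have "\<sigma> * (y t + \<phi> t + D (\<gamma> t) (w t - \<gamma> t)) \<le> \<sigma> * K"
        using K(2)[OF t] \<sigma>(1) by (intro mult_left_mono) auto
      moreover have "\<sigma> * (K - N) + 2 * \<kappa> \<le> \<delta> / 2"
      proof -
        have "\<sigma> * (K - N) \<le> s / m * (K - N)"
          using \<sigma>(3) K(1) delta by (intro mult_right_mono) (auto simp: N_def)
        then have "\<sigma> * (K - N) + 2 * \<kappa> \<le> s / m * (K - N) + 2 * \<kappa>"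
          by (rule add_right_mono)
        also have "\<dots> = s * B" using m(1) by (simp add: B_def N_def \<kappa>_def field_simps)
        finally show ?thesis using sB by (rule order_trans)
      qed
      moreover have "M = N + \<delta> / 2" by (simp add: N_def)
      ultimately show ?thesis using 2 by (simp add: algebra_simps)
    qed
    then have "(1 - \<sigma>) * a t + \<sigma> * y t + \<Phi> (\<eta> t) \<le> M - 3/2 * \<epsilon> * s"
      by (simp add: \<kappa>_def)
    then show ?thesis using 1 by (meson ereal_less_eq(3) order_trans)
  qed
  have "path \<eta>"
    unfolding path_def \<eta>_def using np
    by (intro continuous_intros c\<gamma> cn cw) force
  moreover have "\<eta> 0 = \<gamma> 0" "\<eta> 1 = \<gamma> 1"
    using Q[of 0] Q[of 1] by (auto simp: \<eta>_def Q_def)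
  moreover have "norm (\<eta> t - \<gamma> t) \<le> s" if "t \<in> {0..1}" for t
    using \<eta>_near[OF that] by (simp only: \<eta>_def add_diff_cancel_left')
  ultimately have "ereal (M - \<epsilon> * s) \<le> (SUP t\<in>{0..1}. energy \<Psi> \<Phi> (\<eta> t))"
    using s(1) by (intro mini) simp_all
  also have "\<dots> \<le> ereal (M - 3/2 * \<epsilon> * s)"
    by (intro SUP_least low)
  finally show False using eps s(1) by simp
qed

section \<open>The mountain pass level\<close>

lemma mp_level_ge_ring_bound:
  fixes e :: "'a::real_normed_vector"
  assumes "\<And>u. norm u = \<rho> \<Longrightarrow> ereal \<alpha> \<le> energy \<Psi> \<Phi> u" and "0 \<le> \<rho>" "\<rho> \<le> norm e"
  shows "ereal \<alpha> \<le> mp_level \<Psi> \<Phi> e"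
  unfolding mp_level_def
proof (rule INF_greatest)
  fix \<gamma> assume \<gamma>: "\<gamma> \<in> mp_paths e"
  then have "continuous_on {0..1} (\<lambda>t. norm (\<gamma> t))"
    by (auto simp: mp_paths_def path_def intro: continuous_on_norm)
  then obtain t where t: "0 \<le> t" "t \<le> 1" "norm (\<gamma> t) = \<rho>"
    using IVT'[of "\<lambda>t. norm (\<gamma> t)" 0 \<rho> 1] \<gamma> assms(2,3)
    by (auto simp: mp_paths_def pathstart_def pathfinish_def)
  show "ereal \<alpha> \<le> (SUP t\<in>{0..1}. energy \<Psi> \<Phi> (\<gamma> t))"
    using t by (intro SUP_upper2[of t] assms(1)) auto
qed

lemma mp_level_less_infinity:
  fixes e :: "'a::real_normed_vector"
  assumes conv: "convex_fun \<Psi>" and cont\<Phi>: "continuous_on UNIV \<Phi>"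
    and "energy \<Psi> \<Phi> 0 < \<infinity>" "energy \<Psi> \<Phi> e < \<infinity>"
  shows "mp_level \<Psi> \<Phi> e < \<infinity>"
proof -
  have "\<Psi> 0 < \<infinity>" "\<Psi> e < \<infinity>" using assms(3,4) by (auto simp: energy_def)
  then obtain b0 b1 where b: "\<Psi> 0 \<le> ereal b0" "\<Psi> e \<le> ereal b1"
    by (metis ereal_dense2 less_imp_le)
  let ?\<gamma> = "linepath 0 e"
  have "continuous_on {0..1} (\<lambda>t. (1 - t) * b0 + t * b1 + \<Phi> (?\<gamma> t))"
    by (intro continuous_intros continuous_on_compose2[OF cont\<Phi>]) auto
  then obtain t where t: "\<And>t'. t' \<in> {0..1} \<Longrightarrow>
      (1 - t') * b0 + t' * b1 + \<Phi> (?\<gamma> t') \<le> (1 - t) * b0 + t * b1 + \<Phi> (?\<gamma> t)"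
    using continuous_attains_sup[of "{0..1::real}"] by fastforce
  have "energy \<Psi> \<Phi> (?\<gamma> t') \<le> ereal ((1 - t) * b0 + t * b1 + \<Phi> (?\<gamma> t))" if "t' \<in> {0..1}" for t'
  proof -
    have "\<Psi> (?\<gamma> t') \<le> ereal ((1 - t') * b0 + t' * b1)"
      unfolding linepath_def using that b by (intro convex_fun_epigraph conv) auto
    then have "energy \<Psi> \<Phi> (?\<gamma> t') \<le> ereal ((1 - t') * b0 + t' * b1 + \<Phi> (?\<gamma> t'))"
      unfolding energy_def by (metis add_right_mono plus_ereal.simps(1))
    also have "\<dots> \<le> ereal ((1 - t) * b0 + t * b1 + \<Phi> (?\<gamma> t))"
      using t[OF that] by simp
    finally show ?thesis .
  qed
  then have "(SUP t\<in>{0..1}. energy \<Psi> \<Phi> (?\<gamma> t)) \<le> ereal ((1 - t) * b0 + t * b1 + \<Phi> (?\<gamma> t))"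
    by (intro SUP_least)
  moreover have "mp_level \<Psi> \<Phi> e \<le> (SUP t\<in>{0..1}. energy \<Psi> \<Phi> (?\<gamma> t))"
    unfolding mp_level_def mp_paths_def
    by (intro INF_lower CollectI conjI path_linepath pathstart_linepath pathfinish_linepath)
  ultimately have "mp_level \<Psi> \<Phi> e \<le> ereal ((1 - t) * b0 + t * b1 + \<Phi> (?\<gamma> t))"
    by (rule order_trans[rotated])
  then show ?thesis by (rule le_less_trans) simp
qed

section \<open>Almost critical points near almost optimal paths\<close>

text \<open>
  Ekeland's principle is applied with constant \<open>\<epsilon>\<close> to a path within \<open>\<epsilon>\<^sup>2\<close> of the optimum, so the path
  moves by at most \<open>\<epsilon>\<close>. Paths are modelled by bounded continuous functions on the whole line, whose
  type is a complete metric space. Only paths with energy at most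
  \<open>c + \<epsilon>\<^sup>2\<close> are admitted, which makes the functional real-valued and costs nothing, as every path
  that improves on such a path is admitted too.
\<close>

lemma almost_critical_point_near_path:
  fixes \<Psi> :: "'a::banach \<Rightarrow> ereal" and D :: "'a \<Rightarrow> 'a \<Rightarrow>\<^sub>L real"
  assumes conv: "convex_fun \<Psi>" and lsc: "lower_semicont \<Psi>" and proper: "\<And>x. \<Psi> x \<noteq> -\<infinity>"
    and D: "\<And>x. (\<Phi> has_derivative blinfun_apply (D x)) (at x)"
    and contD: "continuous_on UNIV D"
    and c: "mp_level \<Psi> \<Phi> e = ereal c"
    and \<delta>: "\<delta> > 0" and ends: "energy \<Psi> \<Phi> 0 < ereal (c - \<delta>)" "energy \<Psi> \<Phi> e < ereal (c - \<delta>)"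
    and eps: "\<epsilon> > 0"
    and \<gamma>: "\<gamma> \<in> mp_paths e" and \<gamma>_le: "(SUP t\<in>{0..1}. energy \<Psi> \<Phi> (\<gamma> t)) \<le> ereal (c + \<epsilon>\<^sup>2)"
  obtains x t where "t \<in> {0..1}" "norm (x - \<gamma> t) \<le> \<epsilon>"
    "ereal (c - \<delta>) \<le> energy \<Psi> \<Phi> x" "energy \<Psi> \<Phi> x \<le> ereal (c + \<epsilon>\<^sup>2)"
    "\<And>v. ereal (- (2 * \<epsilon>) * norm (v - x)) \<le> \<Psi> v - \<Psi> x + ereal (D x (v - x))"
proof -
  have cont\<Phi>: "continuous_on UNIV \<Phi>"
    using D by (intro continuous_at_imp_continuous_on) (auto intro: has_derivative_continuous)
  define f where "f g = (SUP t\<in>{0..1}. energy \<Psi> \<Phi> (g t))" for g :: "real \<Rightarrow> 'a"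
  define F where "F G = real_of_ereal (f (apply_bcontfun G))" for G
  define S where "S = {G :: real \<Rightarrow>\<^sub>C 'a. G 0 = 0 \<and> G 1 = e \<and> f G \<le> ereal (c + \<epsilon>\<^sup>2)}"
  have c_le: "ereal c \<le> f g" if "g \<in> mp_paths e" for g
    unfolding c[symmetric] mp_level_def f_def using that by (rule INF_lower)
  have S_path: "apply_bcontfun G \<in> mp_paths e" if "G \<in> S" for G
    using that by (simp add: S_def mp_paths_def path_def pathstart_def pathfinish_def)
  have fF: "f (apply_bcontfun G) = ereal (F G)" if "G \<in> S" for G
    using c_le[OF S_path[OF that]] that
    by (cases "f (apply_bcontfun G)") (auto simp: F_def S_def)
  have f_le_iff: "f g \<le> ereal a \<longleftrightarrow> (\<forall>t\<in>{0..1}. energy \<Psi> \<Phi> (g t) \<le> ereal a)" for g a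
    by (simp add: f_def SUP_le_iff)
  have cont_at: "continuous_on UNIV (\<lambda>G :: real \<Rightarrow>\<^sub>C 'a. G t)" for t
    unfolding continuous_on_iff by (metis dist_fun_lt_imp_dist_val_lt)
  have closed_at: "closed {G :: real \<Rightarrow>\<^sub>C 'a. G t \<in> C}" if "closed C" for C t
    using continuous_closed_vimage[OF that, of "\<lambda>G :: real \<Rightarrow>\<^sub>C 'a. G t"] cont_at
    by (simp add: vimage_def continuous_on_eq_continuous_at)
  have closed_sub: "closed {G \<in> S. F G \<le> a}" for a
  proof -
    have "{G \<in> S. F G \<le> a} = {G :: real \<Rightarrow>\<^sub>C 'a. G 0 \<in> {0}} \<inter> {G :: real \<Rightarrow>\<^sub>C 'a. G 1 \<in> {e}} \<inter>
        (\<Inter>t\<in>{0..1}. {G :: real \<Rightarrow>\<^sub>C 'a. G t \<in> {x. energy \<Psi> \<Phi> x \<le> ereal (min a (c + \<epsilon>\<^sup>2))}})"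
      (is "?L = _")
    proof -
      have "G \<in> ?L \<longleftrightarrow> G 0 = 0 \<and> G 1 = e \<and> f G \<le> ereal (min a (c + \<epsilon>\<^sup>2))" for G
        using fF[of G] by (cases "f G") (auto simp: S_def F_def)
      then show ?thesis unfolding f_le_iff by auto
    qed
    then show ?thesis
      using closed_at closed_energy_le[OF lsc cont\<Phi>]
      by (simp only:) (intro closed_Int closed_INT ballI closed_at closed_singleton)
  qed
  have "closed S"
  proof -
    have "F G \<le> c + \<epsilon>\<^sup>2" if "G \<in> S" for G
      using fF[OF that] that by (simp add: S_def)
    then have "S = {G \<in> S. F G \<le> c + \<epsilon>\<^sup>2}" by auto
    then show ?thesis using closed_sub by metis
  qed
  then have "complete S" by (simp add: complete_eq_closed)
  have "continuous_on (cbox 0 1) \<gamma>" using \<gamma> by (simp add: mp_paths_def path_def)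
  then obtain G0 :: "real \<Rightarrow>\<^sub>C 'a" where "\<And>t. t \<in> cbox 0 1 \<Longrightarrow> G0 t = \<gamma> t"
    by (rule continuous_on_cbox_bcontfunE) (rule that)
  then have G0: "G0 t = \<gamma> t" if "t \<in> {0..1}" for t using that by simp
  have G0S: "G0 \<in> S"
    using \<gamma> \<gamma>_le G0 by (simp add: S_def f_def mp_paths_def pathstart_def pathfinish_def)
  have F_ge: "c \<le> F G" if "G \<in> S" for G
    using c_le[OF S_path[OF that]] fF[OF that] by simp
  obtain G where GS: "G \<in> S" and G_near: "F G + \<epsilon> * dist G0 G \<le> F G0"
    and G_min: "\<And>H. H \<in> S \<Longrightarrow> H \<noteq> G \<Longrightarrow> F G < F H + \<epsilon> * dist G H"
    by (rule ekeland_variational_principle[OF \<open>complete S\<close> G0S eps, of c F])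
      (erule F_ge, rule closed_sub, rule that, assumption+)
  have "F G0 \<le> c + \<epsilon>\<^sup>2" "F G \<le> c + \<epsilon>\<^sup>2" using fF[OF G0S] fF[OF GS] G0S GS by (auto simp: S_def)
  then have "\<epsilon> * dist G0 G \<le> \<epsilon> * \<epsilon>"
    using G_near F_ge[OF GS] by (simp add: power2_eq_square)
  then have dist_G: "dist G0 G \<le> \<epsilon>" using eps by simp
  have mini: "ereal (F G - \<epsilon> * s) \<le> f \<eta>"
    if \<eta>: "path \<eta>" "\<eta> 0 = G 0" "\<eta> 1 = G 1" and s: "s > 0"
      and near: "\<And>t. t \<in> {0..1} \<Longrightarrow> norm (\<eta> t - G t) \<le> s" for \<eta> s
  proof (rule ccontr)
    assume "\<not> ?thesis"
    then have less: "f \<eta> < ereal (F G - \<epsilon> * s)" by simp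
    have "continuous_on (cbox 0 1) (\<lambda>t. \<eta> t - G t)"
      using \<eta>(1) by (intro continuous_intros) (auto simp: path_def cbox_interval)
    \<comment> \<open>The displacement, not the path \<open>\<eta>\<close>, is extended to the line: this keeps the distance to \<open>G\<close>
      outside \<open>{0..1}\<close> under control.\<close>
    then obtain E :: "real \<Rightarrow>\<^sub>C 'a" where E01: "\<And>t. t \<in> cbox 0 1 \<Longrightarrow> E t = \<eta> t - G t"
      and E': "\<And>t. E t = \<eta> (clamp 0 1 t) - G (clamp 0 1 t)"
      by (rule continuous_on_cbox_bcontfunE) (rule that)
    have E: "E t = \<eta> t - G t" if "t \<in> {0..1}" for t using E01 that by simp
    define H where "H = G + E"
    have H: "H t = \<eta> t" if "t \<in> {0..1}" for t
      by (simp add: H_def plus_bcontfun.rep_eq E[OF that])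
    have fH: "f H = f \<eta>" unfolding f_def using H by (intro SUP_cong) auto
    have "ereal (F G - \<epsilon> * s) \<le> ereal (c + \<epsilon>\<^sup>2)"
      using \<open>F G \<le> c + \<epsilon>\<^sup>2\<close> eps s by (simp add: add_increasing2 diff_le_eq)
    with less have "f \<eta> \<le> ereal (c + \<epsilon>\<^sup>2)"
      by (rule less_imp_le[OF less_le_trans])
    then have "H \<in> S"
      using GS \<eta>(2,3) H[of 0] H[of 1] fH by (auto simp: S_def)
    have "norm E \<le> s"
    proof (rule norm_bound)
      fix t
      have "clamp 0 1 t \<in> {0..1::real}" using clamp_in_interval[of 0 1 t] by (simp add: cbox_interval)
      then show "norm (E t) \<le> s" unfolding E' by (rule near)
    qed
    then have "dist G H \<le> s" by (simp add: H_def dist_norm)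
    then have "\<epsilon> * dist G H \<le> \<epsilon> * s" using eps by simp
    moreover have "F G \<le> F H + \<epsilon> * dist G H"
      using G_min[OF \<open>H \<in> S\<close>] by (cases "H = G") auto
    moreover have "F H < F G - \<epsilon> * s"
      using less fF[OF \<open>H \<in> S\<close>] by (simp add: fH)
    ultimately show False by simp
  qed
  have c_\<delta>: "ereal (c - \<delta>) \<le> ereal (F G - \<delta>)" using F_ge[OF GS] by simp
  have "energy \<Psi> \<Phi> (G 0) < ereal (F G - \<delta>)" "energy \<Psi> \<Phi> (G 1) < ereal (F G - \<delta>)"
    using ends[THEN less_le_trans, OF c_\<delta>] GS by (simp_all add: S_def)
  moreover have "energy \<Psi> \<Phi> (G t) \<le> ereal (F G)" if "t \<in> {0..1}" for t
    using f_le_iff[of G "F G"] fF[OF GS] that by simp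
  ultimately obtain t where t: "t \<in> {0..1}" "ereal (F G - \<delta>) \<le> energy \<Psi> \<Phi> (G t)"
    "energy \<Psi> \<Phi> (G t) \<le> ereal (F G)"
    "\<And>v. ereal (- (2 * \<epsilon>) * norm (v - G t)) \<le> \<Psi> v - \<Psi> (G t) + ereal (D (G t) (v - G t))"
    using nearly_minimal_path_meets_almost_critical_point[OF conv lsc proper D contD, of "apply_bcontfun G" "F G" \<delta> \<epsilon>]
      eps \<delta> mini unfolding f_def by (metis continuous_on_apply_bcontfun)
  show thesis
  proof (rule that[OF t(1)])
    show "norm (G t - \<gamma> t) \<le> \<epsilon>"
      using dist_bounded[of G0 t G] dist_G G0[OF t(1)] by (simp add: dist_norm norm_minus_commute)
    show "ereal (c - \<delta>) \<le> energy \<Psi> \<Phi> (G t)"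
      using c_\<delta> t(2) by (rule order_trans)
    show "energy \<Psi> \<Phi> (G t) \<le> ereal (c + \<epsilon>\<^sup>2)"
      using t(3) \<open>F G \<le> c + \<epsilon>\<^sup>2\<close> by (meson ereal_less_eq(3) order_trans)
  qed (rule t(4))
qed

section \<open>A mountain pass point in the range of the projection\<close>

theorem propositionA2:
  fixes \<Psi> :: "'a::banach \<Rightarrow> ereal"
    and \<Phi> :: "'a \<Rightarrow> real"
    and p :: "'a \<Rightarrow> 'a"
    and e :: 'a
    and \<rho> \<alpha> :: real
  assumes "proper_fun \<Psi>" and "convex_fun \<Psi>" and "lower_semicont \<Psi>"
    and "C1_fun \<Phi>"
    and "palais_smale \<Psi> \<Phi>"
    and "energy \<Psi> \<Phi> 0 = 0"
    and "\<rho> > 0" and "\<alpha> > 0"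
    and "\<And>u. norm u = \<rho> \<Longrightarrow> energy \<Psi> \<Phi> u \<ge> ereal \<alpha>"
    and "e \<notin> ball 0 \<rho>" and "energy \<Psi> \<Phi> e \<le> 0"
    and "continuous_on UNIV p"
    and "p 0 = 0" and "p e = e" and "p \<circ> p = p"
    and "\<And>u v. norm (p u - p v) \<le> norm (u - v)"
    and "\<And>u. energy \<Psi> \<Phi> (p u) \<le> energy \<Psi> \<Phi> u"
  shows "\<exists>u \<in> range p. critical_point \<Psi> \<Phi> u \<and> energy \<Psi> \<Phi> u = mp_level \<Psi> \<Phi> e"
proof -
  note conv = \<open>convex_fun \<Psi>\<close> and lsc = \<open>lower_semicont \<Psi>\<close> and p_cont = \<open>continuous_on UNIV p\<close>
  have proper: "\<Psi> x \<noteq> -\<infinity>" for x using \<open>proper_fun \<Psi>\<close> by (simp add: proper_fun_def)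
  obtain D :: "'a \<Rightarrow> 'a \<Rightarrow>\<^sub>L real" where D: "\<And>x. (\<Phi> has_derivative blinfun_apply (D x)) (at x)"
    and contD: "continuous_on UNIV D"
    using \<open>C1_fun \<Phi>\<close> by (auto simp: C1_fun_def)
  have fD: "frechet_derivative \<Phi> (at x) = blinfun_apply (D x)" for x
    using frechet_derivative_at[OF D] by simp
  have cont\<Phi>: "continuous_on UNIV \<Phi>"
    using D by (intro continuous_at_imp_continuous_on) (auto intro: has_derivative_continuous)
  have "ereal \<alpha> \<le> mp_level \<Psi> \<Phi> e"
    using assms(7,9,10) by (intro mp_level_ge_ring_bound[of \<rho>]) auto
  moreover have "mp_level \<Psi> \<Phi> e < \<infinity>"
    using assms(6,11) by (intro mp_level_less_infinity conv cont\<Phi>) auto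
  ultimately obtain c where c: "mp_level \<Psi> \<Phi> e = ereal c" and "\<alpha> \<le> c"
    by (cases "mp_level \<Psi> \<Phi> e") auto
  then have "c > 0" using \<open>\<alpha> > 0\<close> by simp
  define \<epsilon> where "\<epsilon> n = 1 / real (Suc n)" for n
  have \<epsilon>: "0 < \<epsilon> n" "\<epsilon> n \<le> 1" for n by (auto simp: \<epsilon>_def)
  have \<epsilon>0: "\<epsilon> \<longlonglongrightarrow> 0"
    unfolding \<epsilon>_def using LIMSEQ_inverse_real_of_nat by (simp add: inverse_eq_divide)
  have "\<exists>x q. norm (x - p q) \<le> \<epsilon> n \<and> ereal (c - \<epsilon> n) \<le> energy \<Psi> \<Phi> x \<and>
      energy \<Psi> \<Phi> x \<le> ereal (c + \<epsilon> n) \<and>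
      (\<forall>v. ereal (- (2 * \<epsilon> n) * norm (v - x)) \<le> \<Psi> v - \<Psi> x + ereal (D x (v - x)))" for n
  proof -
    have "mp_level \<Psi> \<Phi> e < ereal (c + (\<epsilon> n)\<^sup>2)" using \<epsilon>(1)[of n] by (simp add: c)
    then obtain \<gamma> where \<gamma>: "\<gamma> \<in> mp_paths e" "(SUP t\<in>{0..1}. energy \<Psi> \<Phi> (\<gamma> t)) < ereal (c + (\<epsilon> n)\<^sup>2)"
      unfolding mp_level_def by (auto simp: INF_less_iff)
    have p\<gamma>: "p \<circ> \<gamma> \<in> mp_paths e"
      using \<gamma>(1) \<open>p 0 = 0\<close> \<open>p e = e\<close> p_cont
      by (auto simp: mp_paths_def pathstart_def pathfinish_def
          intro: path_continuous_image continuous_on_subset)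
    have "(SUP t\<in>{0..1}. energy \<Psi> \<Phi> ((p \<circ> \<gamma>) t)) \<le> (SUP t\<in>{0..1}. energy \<Psi> \<Phi> (\<gamma> t))"
      using assms(17) by (intro SUP_mono') simp
    then have p\<gamma>_le: "(SUP t\<in>{0..1}. energy \<Psi> \<Phi> ((p \<circ> \<gamma>) t)) \<le> ereal (c + (\<epsilon> n)\<^sup>2)"
      using \<gamma>(2) by simp
    \<comment> \<open>\<open>\<delta> < c\<close> keeps the endpoints, whose energy is at most \<open>0\<close>, below \<open>c - \<delta>\<close>.\<close>
    define \<delta> where "\<delta> = min (\<epsilon> n) (c / 2)"
    have \<delta>: "\<delta> > 0" "\<delta> \<le> \<epsilon> n" "0 < c - \<delta>" using \<epsilon>(1)[of n] \<open>c > 0\<close> by (auto simp: \<delta>_def)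
    have ends: "energy \<Psi> \<Phi> 0 < ereal (c - \<delta>)" "energy \<Psi> \<Phi> e < ereal (c - \<delta>)"
      using \<delta>(3) assms(6,11) by (auto intro: le_less_trans)
    obtain x t where x: "t \<in> {0..1}" "norm (x - (p \<circ> \<gamma>) t) \<le> \<epsilon> n"
      "ereal (c - \<delta>) \<le> energy \<Psi> \<Phi> x" "energy \<Psi> \<Phi> x \<le> ereal (c + (\<epsilon> n)\<^sup>2)"
      "\<And>v. ereal (- (2 * \<epsilon> n) * norm (v - x)) \<le> \<Psi> v - \<Psi> x + ereal (D x (v - x))"
      by (rule almost_critical_point_near_path[OF conv lsc proper D contD c \<delta>(1) ends \<epsilon>(1) p\<gamma> p\<gamma>_le])
        (rule that, assumption+)
    have "(\<epsilon> n)\<^sup>2 \<le> \<epsilon> n"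
      using \<epsilon>[of n] by (simp add: power2_eq_square mult_left_le_one_le)
    then have "ereal (c + (\<epsilon> n)\<^sup>2) \<le> ereal (c + \<epsilon> n)" "ereal (c - \<epsilon> n) \<le> ereal (c - \<delta>)"
      using \<delta>(2) by auto
    then have "ereal (c - \<epsilon> n) \<le> energy \<Psi> \<Phi> x" "energy \<Psi> \<Phi> x \<le> ereal (c + \<epsilon> n)"
      using x(3,4) order_trans by blast+
    then show ?thesis using x(2,5) unfolding o_def by blast
  qed
  then obtain x q where near: "\<And>n. norm (x n - p (q n)) \<le> \<epsilon> n"
    and lev: "\<And>n. ereal (c - \<epsilon> n) \<le> energy \<Psi> \<Phi> (x n)" "\<And>n. energy \<Psi> \<Phi> (x n) \<le> ereal (c + \<epsilon> n)"
    and ps: "\<And>n v. ereal (- (2 * \<epsilon> n) * norm (v - x n)) \<le> \<Psi> v - \<Psi> (x n) + ereal (D (x n) (v - x n))"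
    by metis
  have dom: "x n \<in> eff_domain \<Psi>" for n
    using lev(2)[of n] by (cases "\<Psi> (x n)") (auto simp: eff_domain_def energy_def)
  have "(\<lambda>n. c - \<epsilon> n) \<longlonglongrightarrow> c" "(\<lambda>n. c + \<epsilon> n) \<longlonglongrightarrow> c"
    using tendsto_diff[OF tendsto_const \<epsilon>0, of c] tendsto_add[OF tendsto_const \<epsilon>0, of c] by simp_all
  then have lim: "(\<lambda>n. energy \<Psi> \<Phi> (x n)) \<longlonglongrightarrow> ereal c"
    by - (rule tendsto_sandwich[of "\<lambda>n. ereal (c - \<epsilon> n)" _ _ "\<lambda>n. ereal (c + \<epsilon> n)"],
        simp_all add: lev)
  have \<epsilon>2: "(\<lambda>n. 2 * \<epsilon> n) \<longlonglongrightarrow> 0" using tendsto_mult_left[OF \<epsilon>0, of 2] by simp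
  then have "filterlim (\<lambda>n. 2 * \<epsilon> n) (at_right 0) sequentially"
    using \<epsilon>(1) by (intro tendsto_imp_filterlim_at_right) simp_all
  then obtain r u where r: "strict_mono r" and u: "(x \<circ> r) \<longlonglongrightarrow> u"
    using \<open>palais_smale \<Psi> \<Phi>\<close>[unfolded palais_smale_def, rule_format, of x c "\<lambda>n. 2 * \<epsilon> n"] dom lim ps
    by (auto simp: fD)
  have lim_r: "(\<lambda>n. energy \<Psi> \<Phi> ((x \<circ> r) n)) \<longlonglongrightarrow> ereal c"
    and \<epsilon>_r: "(\<lambda>n. 2 * \<epsilon> (r n)) \<longlonglongrightarrow> 0" "(\<lambda>n. \<epsilon> (r n)) \<longlonglongrightarrow> 0"
    using LIMSEQ_subseq_LIMSEQ[OF lim r] LIMSEQ_subseq_LIMSEQ[OF \<epsilon>2 r] LIMSEQ_subseq_LIMSEQ[OF \<epsilon>0 r]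
    by (simp_all add: o_def)
  note crit = almost_critical_limit[OF lsc proper cont\<Phi> contD _ u lim_r \<epsilon>_r(1)]
  have "critical_point \<Psi> \<Phi> u" "energy \<Psi> \<Phi> u = ereal c"
    using crit dom ps by (simp_all add: critical_point_def fD)
  moreover have "u \<in> range p"
  proof -
    have "(\<lambda>n. x (r n) - p (q (r n))) \<longlonglongrightarrow> 0"
      using near by (intro Lim_null_comparison[OF _ \<epsilon>_r(2)]) auto
    from tendsto_diff[OF u this] have pq: "(\<lambda>n. p (q (r n))) \<longlonglongrightarrow> u"
      by (simp add: o_def)
    have "(\<lambda>n. p (p (q (r n)))) \<longlonglongrightarrow> p u"
      using continuous_on_tendsto_compose[OF p_cont pq] by simp
    moreover have "p (p z) = p z" for z using \<open>p \<circ> p = p\<close> by (metis comp_apply)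
    ultimately have "p u = u" using pq LIMSEQ_unique by auto
    then show ?thesis by (metis rangeI)
  qed
  ultimately show ?thesis using c by auto
qed

end
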